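(* Let $\sigma$ be a bounded non-decreasing function on $[-\pi,\pi]$, let $$b(t)=\int_{-\pi}^{\pi}e^{it\theta}\,d\sigma(\theta),\quad t\in\mathbb{Z},$$ and let $\lambda_m(N)$ be the maximal eigenvalue (equivalently, the operator norm) of the non-negative Toeplitz matrix $Q_N=(b(j-k))_{j,k=0}^{N-1}$ generated by the non-negative measure $d\sigma$, $N=1,2,\dots$. Then $$\lim_{N\to\infty}\frac{\lambda_m(N)}{N}=\max_{\alpha}m_\alpha,$$ where $\{m_\alpha\}$ is the set of jumps of $\sigma$.
   Context: The function $\sigma$ is split as $\sigma=\sigma_c+\sigma_d$ with $\sigma_c$ continuous non-decreasing and $\sigma_d$ a non-decreasing step function; the (at most countably many) jump points $\theta_\alpha$ of $\sigma$ are the points of growth of $\sigma_d$, and $m_\alpha=\sigma(\theta_\alpha+0)-\sigma(\theta_\alpha-0)$ is the jump of $\sigma$ at $\theta_\alpha$. The jump points are taken as distinct modulo $2\pi$, i.e. the endpoints $-\pi$ and $\pi$ are identified, and the jump at this single point is $[\sigma(\pi)-\sigma(\pi-0)]+[\sigma(-\pi+0)-\sigma(-\pi)]$. If $\sigma$ has no jumps, $\max_\alpha m_\alpha$ is understood to be $0$. *)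

theory Defs
  imports "HOL-Analysis.Analysis" "Jordan_Normal_Form.Char_Poly"
begin

text \<open>
  A non-decreasing function on \<open>[-\<pi>, \<pi>]\<close> need not be right-continuous, whereas \<^const>\<open>interval_measure\<close>
  expects a right-continuous distribution function on the whole real line. So \<open>\<sigma>\<close> is continued by the
  constants \<open>\<sigma>(-\<pi>)\<close> and \<open>\<sigma>(\<pi>)\<close> and then replaced by its right limits. The end points keep their masses
  \<open>\<sigma>(-\<pi>+0) - \<sigma>(-\<pi>)\<close> and \<open>\<sigma>(\<pi>) - \<sigma>(\<pi>-0)\<close>, and the total mass is \<open>\<sigma>(\<pi>) - \<sigma>(-\<pi>)\<close>. Values of \<open>\<sigma>\<close>
  outside \<open>[-\<pi>, \<pi>]\<close> are irrelevant.
\<close>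

definition clamped :: "(real \<Rightarrow> real) \<Rightarrow> real \<Rightarrow> real" where
  "clamped \<sigma> x = \<sigma> (max (- pi) (min pi x))"

definition right_ext :: "(real \<Rightarrow> real) \<Rightarrow> real \<Rightarrow> real" where
  "right_ext \<sigma> x = Lim (at_right x) (clamped \<sigma>)"

definition stieltjes_measure :: "(real \<Rightarrow> real) \<Rightarrow> real measure" where
  "stieltjes_measure \<sigma> = interval_measure (right_ext \<sigma>)"

definition fourier_stieltjes :: "(real \<Rightarrow> real) \<Rightarrow> int \<Rightarrow> complex" where
  "fourier_stieltjes \<sigma> t =
     (LINT \<theta>:{-pi..pi}|stieltjes_measure \<sigma>. exp (\<i> * of_int t * of_real \<theta>))"

definition toeplitz :: "(int \<Rightarrow> complex) \<Rightarrow> nat \<Rightarrow> complex Matrix.mat" where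
  "toeplitz b N = Matrix.mat N N (\<lambda>(j, k). b (int j - int k))"

text \<open>Intended for Hermitian matrices of positive dimension, all of whose eigenvalues are real.\<close>

definition max_eigenvalue :: "complex Matrix.mat \<Rightarrow> real" where
  "max_eigenvalue A = Max {l :: real. eigenvalue A (complex_of_real l)}"

text \<open>The points \<open>-\<pi>\<close> and \<open>\<pi>\<close> are identified; their common representative is \<open>\<pi>\<close>.\<close>

definition jump :: "(real \<Rightarrow> real) \<Rightarrow> real \<Rightarrow> real" where
  "jump \<sigma> \<theta> =
     (if \<theta> = pi
      then (\<sigma> pi - Lim (at_left pi) \<sigma>) + (Lim (at_right (- pi)) \<sigma> - \<sigma> (- pi))
      else Lim (at_right \<theta>) \<sigma> - Lim (at_left \<theta>) \<sigma>)"

definition jump_points :: "(real \<Rightarrow> real) \<Rightarrow> real set" where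
  "jump_points \<sigma> = {\<theta> \<in> {-pi<..pi}. jump \<sigma> \<theta> \<noteq> 0}"

text \<open>
  \<^const>\<open>Max\<close> is only meaningful on finite sets, but there may be infinitely many jumps. A greatest
  jump still exists whenever there is a jump at all, because the jumps have a finite sum.
\<close>

definition max_jump :: "(real \<Rightarrow> real) \<Rightarrow> real" where
  "max_jump \<sigma> =
     (if jump_points \<sigma> = {} then 0 else (GREATEST m. m \<in> jump \<sigma> ` jump_points \<sigma>))"

lemma mono_clamped:
  assumes "mono_on {-pi..pi} \<sigma>"
  shows "mono (clamped \<sigma>)"
  unfolding clamped_def
  by (intro monoI mono_onD[OF assms]) auto

lemma clamped_tendsto_right_ext:
  assumes "mono_on {-pi..pi} \<sigma>"
  shows "(clamped \<sigma> \<longlongrightarrow> right_ext \<sigma> x) (at_right x)"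
proof -
  let ?g = "clamped \<sigma>" and ?l = "Inf (clamped \<sigma> ` {x<..})"
  note mono = mono_clamped[OF assms]
  have bdd: "bdd_below (?g ` {x<..})"
    by (rule bdd_belowI[of _ "?g x"]) (auto intro: monoD[OF mono])
  have ne: "?g ` {x<..} \<noteq> {}" by simp
  have "(?g \<longlongrightarrow> ?l) (at_right x)"
  proof (rule order_tendstoI)
    fix a assume "a < ?l"
    moreover have "?l \<le> ?g y" if "y > x" for y
      using that by (intro cInf_lower bdd) auto
    ultimately show "eventually (\<lambda>y. a < ?g y) (at_right x)"
      by (intro eventually_mono[OF eventually_at_right_less[of x]]) force
  next
    fix a assume "?l < a"
    then obtain z where z: "z > x" "?g z < a"
      using cInf_less_iff[OF ne bdd] by auto
    have "eventually (\<lambda>y. y \<in> {x<..<z}) (at_right x)"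
      using z(1) by (rule eventually_at_right_real)
    then show "eventually (\<lambda>y. ?g y < a) (at_right x)"
    proof eventually_elim
      case (elim y)
      then have "?g y \<le> ?g z" by (intro monoD[OF mono]) auto
      with z(2) show ?case by linarith
    qed
  qed
  then show ?thesis
    unfolding right_ext_def by (metis tendsto_Lim trivial_limit_at_right_real)
qed

lemma clamped_le_right_ext:
  assumes "mono_on {-pi..pi} \<sigma>"
  shows "clamped \<sigma> x \<le> right_ext \<sigma> x"
proof (rule tendsto_lowerbound[OF clamped_tendsto_right_ext[OF assms]])
  show "eventually (\<lambda>y. clamped \<sigma> x \<le> clamped \<sigma> y) (at_right x)"
    by (rule eventually_mono[OF eventually_at_right_less])
       (use monoD[OF mono_clamped[OF assms]] in simp)
qed simp

lemma right_ext_le_clamped: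
  assumes "mono_on {-pi..pi} \<sigma>" "x < y"
  shows "right_ext \<sigma> x \<le> clamped \<sigma> y"
proof (rule tendsto_upperbound[OF clamped_tendsto_right_ext[OF assms(1)]])
  have "eventually (\<lambda>z. z \<in> {x<..<y}) (at_right x)"
    using assms(2) by (rule eventually_at_right_real)
  then show "eventually (\<lambda>z. clamped \<sigma> z \<le> clamped \<sigma> y) (at_right x)"
    by eventually_elim (auto intro: monoD[OF mono_clamped[OF assms(1)]])
qed simp

lemma mono_right_ext:
  assumes "mono_on {-pi..pi} \<sigma>" "x \<le> y"
  shows "right_ext \<sigma> x \<le> right_ext \<sigma> y"
  using right_ext_le_clamped[OF assms(1), of x y] clamped_le_right_ext[OF assms(1), of y] assms(2)
  by (cases "x = y") auto

lemma continuous_right_ext: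
  assumes "mono_on {-pi..pi} \<sigma>"
  shows "continuous (at_right x) (right_ext \<sigma>)"
  unfolding continuous_within
proof (rule order_tendstoI)
  fix a assume "a < right_ext \<sigma> x"
  then show "eventually (\<lambda>y. a < right_ext \<sigma> y) (at_right x)"
    by (intro eventually_mono[OF eventually_at_right_less[of x]])
       (auto elim!: less_le_trans[OF _ mono_right_ext[OF assms]])
next
  fix a assume "right_ext \<sigma> x < a"
  then have "eventually (\<lambda>y. clamped \<sigma> y < a) (at_right x)"
    using order_tendstoD(2)[OF clamped_tendsto_right_ext[OF assms]] by blast
  then obtain b where b: "b > x" "\<And>y. x < y \<Longrightarrow> y < b \<Longrightarrow> clamped \<sigma> y < a"
    by (auto simp: eventually_at_right_field)
  define c where "c = (x + b) / 2"
  have c: "x < c" "clamped \<sigma> c < a" using b by (auto simp: c_def)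
  have "eventually (\<lambda>y. y \<in> {x<..<c}) (at_right x)"
    using c(1) by (rule eventually_at_right_real)
  then show "eventually (\<lambda>y. right_ext \<sigma> y < a) (at_right x)"
  proof eventually_elim
    case (elim y)
    then have "right_ext \<sigma> y \<le> clamped \<sigma> c" by (intro right_ext_le_clamped[OF assms]) auto
    with c(2) show ?case by linarith
  qed
qed

lemma emeasure_stieltjes_measure_Ioc:
  assumes "mono_on {-pi..pi} \<sigma>" "a \<le> b"
  shows "emeasure (stieltjes_measure \<sigma>) {a<..b} = ennreal (right_ext \<sigma> b - right_ext \<sigma> a)"
  unfolding stieltjes_measure_def
  by (intro emeasure_interval_measure_Ioc assms mono_right_ext continuous_right_ext)

end

theory Submission
  imports Defs
begin

text \<open>
  Wrapping the interval around the unit circle turns \<open>d\<sigma>\<close> into a finite measure \<open>\<nu>\<close> on the circle,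
  the points \<open>-\<pi>\<close> and \<open>\<pi>\<close> being glued together. The entries of the Toeplitz matrix become
  \<open>b(j - k) = \<integral> z\<^sup>j cnj(z)\<^sup>k d\<nu>\<close>, and the jumps of \<open>\<sigma>\<close> become the masses of the atoms of \<open>\<nu>\<close>. So the
  claim is that \<open>\<lambda>\<^sub>m(N) / N\<close> tends to the mass \<open>M\<close> of the heaviest atom.

  Lower bound. The quadratic form of the matrix at \<open>x\<close> is \<open>\<integral> \<bar>\<Sum> x\<^sub>k cnj(z)\<^sup>k\<bar>\<^sup>2 d\<nu>\<close>. If \<open>w\<close> carries an atom of
  mass \<open>m\<close>, the vector \<open>x\<^sub>k = w\<^sup>k\<close> has squared norm \<open>N\<close>, and the integrand equals \<open>N\<^sup>2\<close> at \<open>w\<close>. By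
  the Rayleigh principle \<open>\<lambda>\<^sub>m(N) \<ge> N m\<close> (lemma \<open>atom_le_max_eigenvalue\<close>).

  Upper bound. An eigenvector \<open>x\<close> for \<open>\<lambda>\<close> gives the trigonometric polynomial \<open>p(z) = \<Sum> x\<^sub>k cnj(z)\<^sup>k\<close>
  with \<open>\<lambda> p(w) = \<integral> D\<^sub>N(z cnj(w)) p(z) d\<nu>(z)\<close>, where \<open>D\<^sub>N(u) = \<Sum>\<^bsub>k<N\<^esub> u\<^sup>k\<close>. Evaluating at a point \<open>w\<close> where
  \<open>\<bar>p\<bar>\<close> is greatest on the circle and dividing by \<open>\<bar>p(w)\<bar>\<close> yields
  \<open>\<lambda> \<le> sup\<^sub>w \<integral> \<bar>D\<^sub>N(z cnj(w))\<bar> d\<nu>(z)\<close> (lemma \<open>eigenvalue_le_kernel_norm\<close>). The kernel is at most \<open>N\<close> everywhere and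
  at most \<open>2 / d\<close> once \<open>z\<close> and \<open>w\<close> are at distance \<open>d\<close> or more. By compactness of the circle, some \<open>d > 0\<close>
  makes every ball of radius \<open>d\<close> centred on the circle have mass at most \<open>M + \<epsilon>\<close> (lemma \<open>small_balls\<close>). Hence
  \<open>\<lambda>\<^sub>m(N) \<le> N (M + \<epsilon>) + O(1)\<close>.
\<close>

section \<open>The largest eigenvalue of a Hermitian matrix\<close>

text \<open>
  Vectors are functions on the naturals of which only the values below \<open>N\<close> matter. The type then does not
  depend on \<open>N\<close>, and its product topology supplies the compactness of the unit sphere.
\<close>

definition hermitian_form :: "nat \<Rightarrow> (nat \<Rightarrow> nat \<Rightarrow> complex) \<Rightarrow> (nat \<Rightarrow> complex) \<Rightarrow> (nat \<Rightarrow> complex) \<Rightarrow> complex" where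
  "hermitian_form N a x y = (\<Sum>j<N. \<Sum>k<N. cnj (x j) * a j k * y k)"

definition sum_norm_sq :: "nat \<Rightarrow> (nat \<Rightarrow> complex) \<Rightarrow> real" where
  "sum_norm_sq N x = (\<Sum>i<N. (norm (x i))\<^sup>2)"

text \<open>
  The first-order condition of the variational argument: a nonnegative quadratic vanishing at \<open>0\<close> has no
  linear term, because the linear term would dominate near \<open>0\<close>.
\<close>

lemma linear_coeff_eq_0:
  fixes b c :: real
  assumes "\<And>s. 0 \<le> s * b + s\<^sup>2 * c"
  shows "b = 0"
proof (rule ccontr)
  assume b: "b \<noteq> 0"
  \<comment> \<open>A step \<open>-b / K\<close> with \<open>K > c\<close> is short enough to make the value negative.\<close>
  define K where "K = \<bar>c\<bar> + 1"
  have K: "K > 0" "c < K" by (auto simp: K_def)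
  have "(- b / K) * b + (- b / K)\<^sup>2 * c = b\<^sup>2 / K\<^sup>2 * (c - K)"
    using K by (simp add: field_simps power2_eq_square)
  also have "\<dots> < 0"
    using K b by (intro mult_pos_neg) auto
  finally show False using assms[of "- b / K"] by simp
qed

lemma hermitian_form_scale:
  "hermitian_form N a (\<lambda>i. of_real s * x i) (\<lambda>i. of_real s * x i) = of_real (s\<^sup>2) * hermitian_form N a x x"
  unfolding hermitian_form_def sum_distrib_left
  by (intro sum.cong refl) (simp add: power2_eq_square mult_ac)

lemma sum_norm_sq_scale: "sum_norm_sq N (\<lambda>i. of_real s * x i) = s\<^sup>2 * sum_norm_sq N x"
  by (simp add: sum_norm_sq_def sum_distrib_left norm_mult power_mult_distrib)

text \<open>
  Coordinates from \<open>N\<close> on are set to \<open>0\<close>, which places the sphere as a closed set inside a product of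
  closed unit discs; that product is compact by Tychonoff's theorem.
\<close>

lemma compact_unit_sphere_coordinates:
  "compact {x :: nat \<Rightarrow> complex. sum_norm_sq N x = 1 \<and> (\<forall>i\<ge>N. x i = 0)}" (is "compact ?S")
proof -
  let ?K = "Pi\<^sub>E UNIV (\<lambda>i::nat. cball (0::complex) 1)"
  have "compact ?K"
    using compactin_PiE[of "\<lambda>i::nat. euclidean :: complex topology" UNIV "\<lambda>i. cball 0 1"]
    by (simp add: euclidean_product_topology)
  moreover have "closed ?S"
  proof -
    have "?S = {x. sum_norm_sq N x = 1} \<inter> (\<Inter>i\<in>{N..}. {x. x i = 0})" by auto
    moreover have "closed {x :: nat \<Rightarrow> complex. sum_norm_sq N x = 1}"
      unfolding sum_norm_sq_def
      by (intro closed_Collect_eq continuous_intros continuous_on_product_coordinates)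
    moreover have "closed (\<Inter>i\<in>{N..}. {x :: nat \<Rightarrow> complex. x i = 0})"
      by (intro closed_INT ballI closed_Collect_eq continuous_intros continuous_on_product_coordinates)
    ultimately show ?thesis by auto
  qed
  moreover have "?S \<subseteq> ?K"
  proof
    fix x assume x: "x \<in> ?S"
    have "norm (x i) \<le> 1" for i
    proof (cases "i < N")
      case True
      then have "(norm (x i))\<^sup>2 \<le> sum_norm_sq N x"
        unfolding sum_norm_sq_def by (intro member_le_sum) auto
      then show ?thesis using x by (simp add: power2_le_iff_abs_le abs_square_le_1)
    qed (use x in auto)
    then show "x \<in> ?K" by auto
  qed
  ultimately show ?thesis
    using compact_Int_closed[of ?K ?S] by (simp only: inf_absorb2)
qed

lemma rayleigh_maximiser:
  assumes "N > 0"
  obtains v where "sum_norm_sq N v = 1"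
    "\<And>x. Re (hermitian_form N a x x) \<le> Re (hermitian_form N a v v) * sum_norm_sq N x"
proof -
  let ?S = "{x :: nat \<Rightarrow> complex. sum_norm_sq N x = 1 \<and> (\<forall>i\<ge>N. x i = 0)}"
  let ?q = "\<lambda>x. Re (hermitian_form N a x x)"
  have "sum_norm_sq N (\<lambda>i. if i = 0 then 1 else 0) = (\<Sum>i<N. if i = 0 then 1 else 0)"
    unfolding sum_norm_sq_def by (intro sum.cong) auto
  then have "(\<lambda>i. if i = 0 then 1 else 0) \<in> ?S"
    using assms by auto
  then have ne: "?S \<noteq> {}" by blast
  have cont: "continuous_on ?S ?q"
    unfolding hermitian_form_def
    by (intro continuous_intros) (auto intro!: continuous_on_subset[OF continuous_on_product_coordinates])
  obtain v where v: "v \<in> ?S" "\<And>y. y \<in> ?S \<Longrightarrow> ?q y \<le> ?q v"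
    using continuous_attains_sup[OF compact_unit_sphere_coordinates ne cont] by blast
  have "?q x \<le> ?q v * sum_norm_sq N x" for x
  proof (cases "sum_norm_sq N x = 0")
    case True
    then have "x i = 0" if "i < N" for i
      using that by (auto simp: sum_norm_sq_def sum_nonneg_eq_0_iff)
    then show ?thesis using True by (simp add: hermitian_form_def)
  next
    case False
    define c where "c = sum_norm_sq N x"
    have c: "c > 0" using False by (simp add: c_def sum_norm_sq_def sum_nonneg less_le)
    define x' where "x' = (\<lambda>i. if i < N then x i else 0)"
    let ?y = "\<lambda>i. of_real (1 / sqrt c) * x' i"
    have x': "sum_norm_sq N x' = c" "hermitian_form N a x' x' = hermitian_form N a x x"
      by (auto simp: x'_def c_def sum_norm_sq_def hermitian_form_def)
    have "sum_norm_sq N ?y = 1" "?q ?y = ?q x / c"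
      unfolding sum_norm_sq_scale hermitian_form_scale using c x' by (auto simp: power_divide)
    moreover have "?y \<in> ?S" using calculation by (auto simp: x'_def)
    ultimately have "?q x / c \<le> ?q v" using v(2)[of ?y] by simp
    then show ?thesis using c by (simp add: c_def field_simps)
  qed
  with v(1) show ?thesis by (intro that[of v]) auto
qed

text \<open>
  A maximiser \<open>v\<close> of the Rayleigh quotient is an eigenvector. Perturbing \<open>v\<close> in the direction of
  its residual \<open>r = t v - A v\<close>, where \<open>t\<close> is the maximal value, changes \<open>t \<parallel>x\<parallel>\<^sup>2 - \<langle>A x, x\<rangle> \<ge> 0\<close> to first order by
  \<open>2 \<parallel>r\<parallel>\<^sup>2\<close>, and that has to vanish.
\<close>

lemma top_eigenvector_exists:
  assumes "N > 0" and herm: "\<And>j k. a k j = cnj (a j k)"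
  shows "\<exists>(t :: real) v. (\<exists>i<N. v i \<noteq> 0) \<and> (\<forall>j<N. (\<Sum>k<N. a j k * v k) = of_real t * v j) \<and>
    (\<forall>x. Re (hermitian_form N a x x) \<le> t * sum_norm_sq N x)"
proof -
  let ?q = "\<lambda>x. Re (hermitian_form N a x x)"
  obtain v where v: "sum_norm_sq N v = 1" "\<And>x. ?q x \<le> ?q v * sum_norm_sq N x"
    using rayleigh_maximiser[where N = N and a = a, OF assms(1)] by metis
  define t where "t = ?q v"
  define r where "r j = of_real t * v j - (\<Sum>k<N. a j k * v k)" for j
  let ?ip = "Re (\<Sum>j<N. cnj (r j) * v j)"
  have "0 \<le> s * (2 * (t * ?ip - Re (hermitian_form N a r v)))
     + s\<^sup>2 * (t * sum_norm_sq N r - ?q r)" for s :: real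
  proof -
    let ?x = "\<lambda>i. v i + of_real s * r i"
    have sym: "Re (hermitian_form N a v r) = Re (hermitian_form N a r v)"
    proof -
      have "hermitian_form N a v r = cnj (hermitian_form N a r v)"
        unfolding hermitian_form_def cnj_sum
        by (subst sum.swap, intro sum.cong refl) (subst herm, simp add: mult_ac)
      then show ?thesis by simp
    qed
    have "hermitian_form N a ?x ?x = hermitian_form N a v v + of_real s * hermitian_form N a v r
      + of_real s * hermitian_form N a r v + of_real (s\<^sup>2) * hermitian_form N a r r"
      unfolding hermitian_form_def sum_distrib_left sum.distrib[symmetric]
      by (intro sum.cong refl) (simp add: algebra_simps power2_eq_square)
    then have 1: "?q ?x = t + 2 * s * Re (hermitian_form N a r v) + s\<^sup>2 * ?q r"
      using sym by (simp add: t_def)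
    have "sum_norm_sq N ?x = sum_norm_sq N v + 2 * s * ?ip + s\<^sup>2 * sum_norm_sq N r"
      unfolding sum_norm_sq_def sum_distrib_left Re_sum sum.distrib[symmetric]
      by (intro sum.cong refl) (unfold cmod_power2, simp add: algebra_simps power2_eq_square)
    then have 2: "sum_norm_sq N ?x = 1 + 2 * s * ?ip + s\<^sup>2 * sum_norm_sq N r" using v by simp
    show ?thesis using v(2)[of ?x] unfolding t_def[symmetric] 1 2 by (simp add: algebra_simps)
  qed
  then have "2 * (t * ?ip - Re (hermitian_form N a r v)) = 0"
    by (rule linear_coeff_eq_0)
  moreover have "t * ?ip - Re (hermitian_form N a r v) = sum_norm_sq N r"
  proof -
    have "t * ?ip - Re (hermitian_form N a r v)
        = Re (\<Sum>j<N. cnj (r j) * (of_real t * v j - (\<Sum>k<N. a j k * v k)))"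
      unfolding hermitian_form_def
      by (simp add: right_diff_distrib sum_subtractf sum_distrib_left mult_ac)
    also have "\<dots> = Re (\<Sum>j<N. cnj (r j) * r j)"
      by (simp only: r_def[symmetric])
    also have "\<dots> = sum_norm_sq N r"
      unfolding sum_norm_sq_def cmod_power2 by (simp add: power2_eq_square)
    finally show ?thesis .
  qed
  ultimately have "sum_norm_sq N r = 0" by simp
  then have r0: "r j = 0" if "j < N" for j
    using that by (auto simp: sum_norm_sq_def sum_nonneg_eq_0_iff)
  show ?thesis
  proof (rule exI[of _ t], rule exI[of _ v], intro conjI allI impI)
    show "\<exists>i<N. v i \<noteq> 0"
    proof (rule ccontr)
      assume "\<not> ?thesis"
      then have "sum_norm_sq N v = 0" by (simp add: sum_norm_sq_def)
      with v(1) show False by simp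
    qed
    show "(\<Sum>k<N. a j k * v k) = of_real t * v j" if "j < N" for j
      using r0[OF that] by (simp add: r_def)
    show "?q x \<le> t * sum_norm_sq N x" for x using v(2) by (simp add: t_def)
  qed
qed

lemma eigenvalue_mat_iff:
  "eigenvalue (Matrix.mat N N (\<lambda>(j, k). a j k)) l \<longleftrightarrow>
    (\<exists>v. (\<exists>i<N. v i \<noteq> 0) \<and> (\<forall>j<N. (\<Sum>k<N. a j k * v k) = l * v j))" (is "?L \<longleftrightarrow> ?R")
  for a :: "nat \<Rightarrow> nat \<Rightarrow> complex"
proof
  assume ?L
  then obtain v where v: "v \<in> carrier_vec N" "v \<noteq> 0\<^sub>v N"
    "Matrix.mat N N (\<lambda>(j, k). a j k) *\<^sub>v v = l \<cdot>\<^sub>v v"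
    by (auto simp: eigenvalue_def eigenvector_def)
  have "(\<Sum>k<N. a j k * vec_index v k) = l * vec_index v j" if "j < N" for j
    using arg_cong[OF v(3), of "\<lambda>w. vec_index w j"] v(1) that
    by (simp add: scalar_prod_def lessThan_atLeast0)
  moreover have "\<exists>i<N. vec_index v i \<noteq> 0" using v(1,2) by auto
  ultimately show ?R by (intro exI[of _ "vec_index v"]) blast
next
  assume ?R
  then obtain v i where v: "i < N" "v i \<noteq> 0" "\<And>j. j < N \<Longrightarrow> (\<Sum>k<N. a j k * v k) = l * v j" by auto
  have "eigenvector (Matrix.mat N N (\<lambda>(j, k). a j k)) (Matrix.vec N v) l"
    unfolding eigenvector_def
  proof (intro conjI)
    show "Matrix.vec N v \<noteq> 0\<^sub>v (dim_row (Matrix.mat N N (\<lambda>(j, k). a j k)))"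
      using v(1,2) by (metis dim_row_mat(1) index_vec index_zero_vec(1))
    show "Matrix.mat N N (\<lambda>(j, k). a j k) *\<^sub>v Matrix.vec N v = l \<cdot>\<^sub>v Matrix.vec N v"
      using v(3) by (intro eq_vecI) (auto simp: scalar_prod_def lessThan_atLeast0)
  qed simp
  then show ?L by (auto simp: eigenvalue_def)
qed

text \<open>
  The set in the definition of \<^const>\<open>max_eigenvalue\<close> is finite, being made of roots of the characteristic
  polynomial, and nonempty, as it contains the maximum of the Rayleigh quotient. So its \<^const>\<open>Max\<close> is an
  eigenvalue and dominates that quotient.
\<close>

lemma max_eigenvalue_hermitian:
  fixes a :: "nat \<Rightarrow> nat \<Rightarrow> complex" and N :: nat
  defines "A \<equiv> Matrix.mat N N (\<lambda>(j, k). a j k)"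
  assumes N: "N > 0" and herm: "\<And>j k. a k j = cnj (a j k)"
  shows "eigenvalue A (of_real (max_eigenvalue A))"
    and "Re (hermitian_form N a x x) \<le> max_eigenvalue A * sum_norm_sq N x"
proof -
  let ?E = "{l :: real. eigenvalue A (complex_of_real l)}"
  obtain t v where t: "(\<exists>i<N. v i \<noteq> 0) \<and> (\<forall>j<N. (\<Sum>k<N. a j k * v k) = of_real t * v j) \<and>
      (\<forall>x. Re (hermitian_form N a x x) \<le> t * sum_norm_sq N x)"
    using top_eigenvector_exists[where N = N and a = a, OF N herm] by (elim exE) (rule that)
  have "t \<in> ?E"
    unfolding A_def eigenvalue_mat_iff mem_Collect_eq using t by (intro exI[of _ v]) simp
  have carr: "A \<in> carrier_mat N N" by (simp add: A_def)
  have "finite (of_real -` {z. poly (char_poly A) z = 0} :: real set)"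
    using degree_monic_char_poly[OF carr] by (intro finite_vimageI poly_roots_finite inj_of_real) auto
  then have fin: "finite ?E"
    by (rule rev_finite_subset) (auto simp: eigenvalue_root_char_poly[OF carr])
  show "eigenvalue A (of_real (max_eigenvalue A))"
    using Max_in[OF fin] \<open>t \<in> ?E\<close> unfolding max_eigenvalue_def by blast
  have "t \<le> max_eigenvalue A"
    unfolding max_eigenvalue_def using fin \<open>t \<in> ?E\<close> by (intro Max_ge)
  then have "t * sum_norm_sq N x \<le> max_eigenvalue A * sum_norm_sq N x"
    by (intro mult_right_mono) (auto simp: sum_norm_sq_def sum_nonneg)
  then show "Re (hermitian_form N a x x) \<le> max_eigenvalue A * sum_norm_sq N x"
    using t by (meson order_trans)
qed

section \<open>Toeplitz matrices of measures on the unit circle\<close>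

locale circle_measure = finite_measure \<nu> for \<nu> :: "complex measure" +
  assumes sets_eq[measurable_cong]: "sets \<nu> = sets borel"
    and on_circle: "AE z in \<nu>. norm z = 1"
begin

text \<open>
  On the circle \<open>z\<^sup>j cnj(z)\<^sup>k = z\<^bsup>j - k\<^esup>\<close>, so these are the entries of the Toeplitz matrix of \<open>\<nu>\<close>. Two
  natural exponents make the integrand a polynomial in \<open>z\<close> and \<open>cnj(z)\<close>, which factorises in sums over
  \<open>j\<close> and \<open>k\<close> and is continuous at \<open>0\<close>.
\<close>

definition moment :: "nat \<Rightarrow> nat \<Rightarrow> complex" where
  "moment j k = (LINT z|\<nu>. z ^ j * cnj z ^ k)"

lemma space_eq: "space \<nu> = UNIV"
  using sets_eq_imp_space_eq[OF sets_eq] by simp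

lemma borel_measurable_continuous:
  fixes f :: "complex \<Rightarrow> 'b :: topological_space"
  assumes "continuous_on UNIV f"
  shows "f \<in> borel_measurable \<nu>"
  using borel_measurable_continuous_onI[OF assms] by (simp add: measurable_def sets_eq space_eq)

text \<open>
  A continuous function is bounded on the compact circle, which carries all the mass.
\<close>

lemma integrable_continuous:
  fixes f :: "complex \<Rightarrow> 'b :: {banach, second_countable_topology}"
  assumes "continuous_on UNIV f"
  shows "integrable \<nu> f"
proof -
  have "compact (f ` sphere 0 1)"
    by (intro compact_continuous_image continuous_on_subset[OF assms]) auto
  then obtain B where B: "\<And>z. z \<in> sphere 0 1 \<Longrightarrow> norm (f z) \<le> B"
    by (meson bounded_iff compact_imp_bounded imageI)
  have "AE z in \<nu>. norm (f z) \<le> B"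
    using on_circle by eventually_elim (use B in auto)
  then show ?thesis
    by (intro integrable_const_bound borel_measurable_continuous assms)
qed

lemma hermitian_moment: "moment k j = cnj (moment j k)"
  unfolding moment_def
  by (simp add: mult.commute flip: Bochner_Integration.integral_cnj)

lemma integrable_moment: "integrable \<nu> (\<lambda>z. c * (z ^ j * cnj z ^ k))"
  by (intro integrable_continuous continuous_intros)

lemma hermitian_form_moment:
  "hermitian_form N moment x x = of_real (LINT z|\<nu>. (norm (\<Sum>k<N. x k * cnj z ^ k))\<^sup>2)"
proof -
  have "hermitian_form N moment x x
      = (\<Sum>j<N. \<Sum>k<N. LINT z|\<nu>. cnj (x j) * x k * (z ^ j * cnj z ^ k))"
    unfolding hermitian_form_def moment_def by (intro sum.cong refl) (simp add: mult_ac)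
  also have "\<dots> = (LINT z|\<nu>. (\<Sum>j<N. \<Sum>k<N. cnj (x j) * x k * (z ^ j * cnj z ^ k)))"
    by (simp add: Bochner_Integration.integral_sum Bochner_Integration.integrable_sum integrable_moment
        del: integral_mult_right_zero integral_mult_left_zero)
  also have "\<dots> = (LINT z|\<nu>. of_real ((norm (\<Sum>k<N. x k * cnj z ^ k))\<^sup>2))"
  proof (intro Bochner_Integration.integral_cong refl)
    fix z
    have "(\<Sum>j<N. \<Sum>k<N. cnj (x j) * x k * (z ^ j * cnj z ^ k))
      = cnj (\<Sum>j<N. x j * cnj z ^ j) * (\<Sum>k<N. x k * cnj z ^ k)"
      unfolding cnj_sum sum_product by (intro sum.cong refl) (simp add: mult_ac)
    then show "(\<Sum>j<N. \<Sum>k<N. cnj (x j) * x k * (z ^ j * cnj z ^ k))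
      = of_real ((norm (\<Sum>k<N. x k * cnj z ^ k))\<^sup>2)"
      by (simp only: complex_norm_square mult.commute)
  qed
  also have "\<dots> = of_real (LINT z|\<nu>. (norm (\<Sum>k<N. x k * cnj z ^ k))\<^sup>2)"
    by (intro Bochner_Integration.integral_of_real integrable_continuous continuous_intros)
  finally show ?thesis .
qed

text \<open>
  The test vector \<open>k \<mapsto> w\<^sup>k\<close> is resonant with the atom at \<open>w\<close>: all terms of the polynomial
  \<open>\<Sum> w\<^sup>k cnj(z)\<^sup>k\<close> equal \<open>1\<close> at \<open>z = w\<close>, so that point alone contributes \<open>N\<^sup>2\<close> times its mass.
\<close>

lemma atom_le_max_eigenvalue:
  assumes N: "N > 0" and w: "norm w = 1"
  shows "N * measure \<nu> {w} \<le> max_eigenvalue (Matrix.mat N N (\<lambda>(j, k). moment j k))"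
proof -
  let ?l = "max_eigenvalue (Matrix.mat N N (\<lambda>(j, k). moment j k))"
  let ?f = "\<lambda>z. (norm (\<Sum>k<N. w ^ k * cnj z ^ k))\<^sup>2"
  have ww: "w * cnj w = 1" using w by (simp add: complex_norm_square[symmetric])
  have "(LINT z|\<nu>. real N ^ 2 * indicator {w} z) \<le> (LINT z|\<nu>. ?f z)"
  proof (rule integral_mono)
    show "integrable \<nu> (\<lambda>z. real N ^ 2 * indicator {w} z)"
      by (intro integrable_mult_right) (simp add: integrable_indicator_iff sets_eq emeasure_finite less_top[symmetric])
    show "integrable \<nu> ?f"
      by (intro integrable_continuous continuous_intros)
    show "real N ^ 2 * indicator {w} z \<le> ?f z" for z
      by (auto simp: indicator_def power_mult_distrib[symmetric] ww)
  qed
  then have "real N ^ 2 * measure \<nu> {w} \<le> Re (hermitian_form N moment (\<lambda>k. w ^ k) (\<lambda>k. w ^ k))"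
    by (simp add: hermitian_form_moment sets_eq)
  also have "\<dots> \<le> ?l * sum_norm_sq N (\<lambda>k. w ^ k)"
    using max_eigenvalue_hermitian(2)[OF N hermitian_moment] .
  also have "sum_norm_sq N (\<lambda>k. w ^ k) = N"
    using w by (simp add: sum_norm_sq_def norm_power)
  finally show ?thesis using N by (simp add: power2_eq_square)
qed

text \<open>
  The \<open>L\<^sup>1\<close> norm of the Dirichlet kernel centred at \<open>w\<close>.
\<close>

definition kernel_norm :: "nat \<Rightarrow> complex \<Rightarrow> real" where
  "kernel_norm N w = (LINT z|\<nu>. norm (\<Sum>k<N. (z * cnj w) ^ k))"

text \<open>
  Passing from the vector \<open>x\<close> to the polynomial \<open>p(z) = \<Sum> x\<^sub>k cnj(z)\<^sup>k\<close> makes an eigenvector of the matrix an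
  eigenfunction of the integral operator with kernel \<open>\<Sum> (z cnj(w))\<^sup>k\<close>. The sup norm of \<open>p\<close> over the circle is
  attained, and comparing both sides of the eigenvalue equation at such a point bounds the eigenvalue by the
  greatest \<open>L\<^sup>1\<close> norm of the kernel. This replaces \<open>L\<^sup>2\<close> estimates, for which contributions of
  several separated atoms would have to be controlled simultaneously.
\<close>

lemma eigenvalue_le_kernel_norm:
  assumes ev: "eigenvalue (Matrix.mat N N (\<lambda>(j, k). moment j k)) (of_real l)"
    and C: "\<And>w. norm w = 1 \<Longrightarrow> kernel_norm N w \<le> C"
  shows "l \<le> C"
proof -
  obtain x i where x: "i < N" "x i \<noteq> 0" and
    eq: "\<And>j. j < N \<Longrightarrow> (\<Sum>k<N. moment j k * x k) = of_real l * x j"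
    using ev unfolding eigenvalue_mat_iff by auto
  define p where "p z = (\<Sum>k<N. x k * cnj z ^ k)" for z
  have cont: "continuous_on A p" for A
    unfolding p_def by (intro continuous_intros)
  have eq': "of_real l * x j = (LINT z|\<nu>. z ^ j * p z)" if "j < N" for j
  proof -
    have "(LINT z|\<nu>. z ^ j * p z) = (LINT z|\<nu>. (\<Sum>k<N. x k * (z ^ j * cnj z ^ k)))"
      by (simp add: p_def sum_distrib_left mult_ac)
    also have "\<dots> = (\<Sum>k<N. LINT z|\<nu>. x k * (z ^ j * cnj z ^ k))"
      by (intro Bochner_Integration.integral_sum integrable_moment)
    also have "\<dots> = (\<Sum>k<N. moment j k * x k)"
      by (simp add: moment_def mult.commute)
    finally show ?thesis using eq[OF that] by simp
  qed
  have p_eq: "of_real l * p w = (LINT z|\<nu>. (\<Sum>k<N. (z * cnj w) ^ k) * p z)" for w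
  proof -
    have "of_real l * p w = (\<Sum>j<N. cnj w ^ j * (of_real l * x j))"
      by (simp add: p_def sum_distrib_left mult_ac)
    also have "\<dots> = (\<Sum>j<N. cnj w ^ j * (LINT z|\<nu>. z ^ j * p z))"
      by (intro sum.cong refl) (simp add: eq')
    also have "\<dots> = (\<Sum>j<N. LINT z|\<nu>. cnj w ^ j * (z ^ j * p z))"
      by simp
    also have "\<dots> = (LINT z|\<nu>. (\<Sum>j<N. cnj w ^ j * (z ^ j * p z)))"
      by (intro Bochner_Integration.integral_sum[symmetric] integrable_continuous continuous_intros cont)
    also have "\<dots> = (LINT z|\<nu>. (\<Sum>k<N. (z * cnj w) ^ k) * p z)"
      unfolding sum_distrib_right
      by (intro Bochner_Integration.integral_cong sum.cong refl) (simp add: power_mult_distrib mult_ac)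
    finally show ?thesis .
  qed
  have "continuous_on (sphere 0 1) (\<lambda>z. norm (p z))" by (intro continuous_intros cont)
  then obtain w where w: "norm w = 1" and "\<forall>z\<in>sphere 0 1. norm (p z) \<le> norm (p w)"
    using continuous_attains_sup[of "sphere (0::complex) 1" "\<lambda>z. norm (p z)"] by auto
  then have max: "norm (p z) \<le> norm (p w)" if "norm z = 1" for z using that by auto
  have bound: "\<bar>l\<bar> * norm (p w) \<le> C * norm (p w)"
  proof -
    have "\<bar>l\<bar> * norm (p w) = norm (LINT z|\<nu>. (\<Sum>k<N. (z * cnj w) ^ k) * p z)"
      by (simp flip: p_eq add: norm_mult)
    also have "\<dots> \<le> (LINT z|\<nu>. norm ((\<Sum>k<N. (z * cnj w) ^ k) * p z))"
      by (rule Bochner_Integration.integral_norm_bound)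
    also have "\<dots> \<le> (LINT z|\<nu>. norm (\<Sum>k<N. (z * cnj w) ^ k) * norm (p w))"
    proof (rule integral_mono_AE)
      show "integrable \<nu> (\<lambda>z. norm ((\<Sum>k<N. (z * cnj w) ^ k) * p z))"
        "integrable \<nu> (\<lambda>z. norm (\<Sum>k<N. (z * cnj w) ^ k) * norm (p w))"
        by (intro integrable_continuous continuous_intros cont)+
      show "AE z in \<nu>. norm ((\<Sum>k<N. (z * cnj w) ^ k) * p z) \<le> norm (\<Sum>k<N. (z * cnj w) ^ k) * norm (p w)"
        using on_circle by eventually_elim (simp add: norm_mult mult_left_mono max)
    qed
    also have "\<dots> = kernel_norm N w * norm (p w)" by (simp add: kernel_norm_def)
    also have "\<dots> \<le> C * norm (p w)" using C[OF w] by (intro mult_right_mono) auto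
    finally show ?thesis .
  qed
  show ?thesis
  proof (cases "p w = 0")
    case True
    \<comment> \<open>If \<open>p\<close> vanishes on the circle, the eigenvalue equation at the nonzero entry \<open>x i\<close> forces \<open>l = 0\<close>.\<close>
    have "AE z in \<nu>. z ^ i * p z = 0"
      using on_circle by eventually_elim (use max True in auto)
    then have "(LINT z|\<nu>. z ^ i * p z) = 0"
      by (rule integral_eq_zero_AE)
    then have "l = 0" using eq'[OF x(1)] x(2) by simp
    moreover have "0 \<le> kernel_norm N 1" by (simp add: kernel_norm_def)
    ultimately show ?thesis using C[of 1] by simp
  next
    case False
    then show ?thesis using bound by simp
  qed
qed

text \<open>
  Around each single point, balls shrink to an atom of mass at most \<open>M\<close>, so a small one has mass at most
  \<open>M + e\<close>. A Lebesgue number of the covering of the circle by these balls is a radius that serves all points.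
\<close>

lemma small_balls:
  assumes atoms: "\<And>w. norm w = 1 \<Longrightarrow> measure \<nu> {w} \<le> M" and "e > 0"
  obtains d where "d > 0" "\<And>w. norm w = 1 \<Longrightarrow> measure \<nu> (ball w d) \<le> M + e"
proof -
  have "\<exists>r>0. measure \<nu> (ball w r) \<le> M + e" if "norm w = 1" for w
  proof -
    have "(\<lambda>n. measure \<nu> (ball w (1 / Suc n))) \<longlonglongrightarrow> measure \<nu> (\<Inter>n. ball w (1 / Suc n))"
    proof (rule finite_Lim_measure_decseq)
      show "range (\<lambda>n. ball w (1 / Suc n)) \<subseteq> sets \<nu>" by (auto simp: sets_eq)
      show "decseq (\<lambda>n. ball w (1 / Suc n))"
        by (intro decseq_SucI subset_ball) (simp add: field_simps)
    qed
    also have "(\<Inter>n. ball w (1 / Suc n)) = {w}"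
    proof -
      have "z = w" if "\<And>n. dist w z < 1 / Suc n" for z
        using that nat_approx_posE[of "dist w z"] by (metis less_asym zero_less_dist_iff)
      then show ?thesis by auto
    qed
    finally have "eventually (\<lambda>n. measure \<nu> (ball w (1 / Suc n)) < M + e) sequentially"
      using atoms[OF that] \<open>e > 0\<close> by (intro order_tendstoD(2)) auto
    then obtain n where "measure \<nu> (ball w (1 / Suc n)) < M + e"
      by (auto simp: eventually_sequentially)
    then show ?thesis by (intro exI[of _ "1 / Suc n"]) auto
  qed
  then obtain r where r: "\<And>w. norm w = 1 \<Longrightarrow> r w > 0 \<and> measure \<nu> (ball w (r w)) \<le> M + e"
    by metis
  let ?G = "(\<lambda>w. ball w (r w)) ` sphere 0 1"
  have "sphere 0 1 \<subseteq> \<Union>?G" using r by force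
  then obtain d where d: "d > 0" "\<And>w. w \<in> sphere 0 1 \<Longrightarrow> \<exists>G\<in>?G. ball w d \<subseteq> G"
    by (rule Heine_Borel_lemma[OF compact_sphere]) auto
  show ?thesis
  proof (rule that[OF d(1)])
    fix w :: complex assume "norm w = 1"
    then obtain u where u: "norm u = 1" "ball w d \<subseteq> ball u (r u)" using d(2)[of w] by auto
    then have "measure \<nu> (ball w d) \<le> measure \<nu> (ball u (r u))"
      by (intro finite_measure_mono) (auto simp: sets_eq)
    then show "measure \<nu> (ball w d) \<le> M + e" using r[OF u(1)] by linarith
  qed
qed

text \<open>
  Away from \<open>z = w\<close> the geometric sum is \<open>(u\<^sup>N - 1) / (u - 1)\<close> with \<open>u = z cnj(w)\<close>. Its numerator is at most \<open>2\<close>, and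
  \<open>\<bar>u - 1\<bar>\<close> is the distance from \<open>z\<close> to \<open>w\<close>.
\<close>

lemma norm_geometric_sum_le:
  assumes "norm z = 1" "norm w = 1"
  shows "norm (\<Sum>k<N. (z * cnj w) ^ k) \<le> real N"
    and "d \<le> dist w z \<Longrightarrow> d > 0 \<Longrightarrow> norm (\<Sum>k<N. (z * cnj w) ^ k) \<le> 2 / d"
proof -
  let ?u = "z * cnj w"
  have u: "norm ?u = 1" using assms by (simp add: norm_mult)
  show "norm (\<Sum>k<N. ?u ^ k) \<le> real N"
    using norm_sum[of "\<lambda>k. ?u ^ k" "{..<N}"] u by (simp add: norm_power)
  assume d: "d \<le> dist w z" "d > 0"
  have "w * cnj w = 1" using assms by (simp add: complex_norm_square[symmetric])
  then have "?u - 1 = (z - w) * cnj w" by (simp add: algebra_simps)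
  then have n: "norm (?u - 1) = dist w z"
    using assms by (simp add: norm_mult dist_norm norm_minus_commute)
  then have ne: "?u \<noteq> 1" using d by auto
  have "norm (\<Sum>k<N. ?u ^ k) = norm (?u ^ N - 1) / dist w z"
    using geometric_sum[OF ne, of N] n by (simp add: norm_divide)
  also have "\<dots> \<le> 2 / d"
  proof (rule frac_le)
    show "norm (?u ^ N - 1) \<le> 2"
      using norm_triangle_ineq4[of "?u ^ N" 1] u by (simp add: norm_power)
  qed (use d in auto)
  finally show "norm (\<Sum>k<N. ?u ^ k) \<le> 2 / d" .
qed

lemma kernel_norm_le:
  assumes w: "norm w = 1" and d: "d > 0"
  shows "kernel_norm N w \<le> N * measure \<nu> (ball w d) + 2 / d * measure \<nu> UNIV"
proof -
  have int: "integrable \<nu> (\<lambda>z. real N * indicator (ball w d) z)"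
    by (intro integrable_mult_right) (simp add: integrable_indicator_iff sets_eq emeasure_finite less_top[symmetric])
  have "kernel_norm N w \<le> (LINT z|\<nu>. real N * indicator (ball w d) z + 2 / d)"
    unfolding kernel_norm_def
  proof (rule integral_mono_AE)
    show "integrable \<nu> (\<lambda>z. norm (\<Sum>k<N. (z * cnj w) ^ k))"
      by (intro integrable_continuous continuous_intros)
    show "integrable \<nu> (\<lambda>z. real N * indicator (ball w d) z + 2 / d)"
      by (intro Bochner_Integration.integrable_add int integrable_const)
    show "AE z in \<nu>. norm (\<Sum>k<N. (z * cnj w) ^ k) \<le> real N * indicator (ball w d) z + 2 / d"
      using on_circle
    proof eventually_elim
      case (elim z)
      show ?case
      proof (cases "z \<in> ball w d")
        case True
        then show ?thesis using norm_geometric_sum_le(1)[OF elim w, of N] d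
          by (simp add: add_increasing2)
      next
        case False
        then show ?thesis using norm_geometric_sum_le(2)[OF elim w, of d N] d by simp
      qed
    qed
  qed
  also have "\<dots> = N * measure \<nu> (ball w d) + 2 / d * measure \<nu> UNIV"
    using int by (subst Bochner_Integration.integral_add) (auto simp: space_eq sets_eq)
  finally show ?thesis .
qed

text \<open>
  The error term \<open>K\<close> comes from the part of the kernel at distance at least \<open>d\<close> from its centre. It depends
  on \<open>e\<close> through \<open>d\<close> but not on \<open>N\<close>, so it is below \<open>N e / 2\<close> for large \<open>N\<close>.
\<close>

lemma max_eigenvalue_over_size_tendsto:
  assumes atoms: "\<And>w. norm w = 1 \<Longrightarrow> measure \<nu> {w} \<le> M"
    and attained: "norm w = 1" "measure \<nu> {w} = M"
  shows "(\<lambda>N. max_eigenvalue (Matrix.mat N N (\<lambda>(j, k). moment j k)) / real N) \<longlonglongrightarrow> M"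
proof (rule LIMSEQ_I)
  let ?l = "\<lambda>N. max_eigenvalue (Matrix.mat N N (\<lambda>(j, k). moment j k))"
  fix e :: real assume "e > 0"
  then obtain d where d: "d > 0" "\<And>w. norm w = 1 \<Longrightarrow> measure \<nu> (ball w d) \<le> M + e / 2"
    using small_balls[OF atoms, of "e / 2"] by (metis half_gt_zero)
  define K where "K = 2 / d * measure \<nu> UNIV"
  have K: "K \<ge> 0" using d by (simp add: K_def)
  show "\<exists>N0. \<forall>N\<ge>N0. norm (?l N / real N - M) < e"
  proof (intro exI allI impI)
    fix N assume N: "N \<ge> Suc (nat \<lceil>2 * K / e\<rceil>)"
    then have N0: "N > 0" by simp
    have "2 * K / e < N" using N by linarith
    then have K': "K < N * (e / 2)" using \<open>e > 0\<close> by (simp add: field_simps)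
    have "N * M \<le> ?l N" using atom_le_max_eigenvalue[OF N0 attained(1)] attained(2) by simp
    then have lower: "M \<le> ?l N / N" using N0 by (simp add: field_simps)
    have "?l N \<le> N * (M + e / 2) + K"
    proof (rule eigenvalue_le_kernel_norm[OF max_eigenvalue_hermitian(1)[OF N0 hermitian_moment]])
      fix u :: complex assume u: "norm u = 1"
      have "kernel_norm N u \<le> N * measure \<nu> (ball u d) + K"
        unfolding K_def by (rule kernel_norm_le[OF u d(1)])
      also have "\<dots> \<le> N * (M + e / 2) + K"
        using d(2)[OF u] by (intro add_right_mono mult_left_mono) auto
      finally show "kernel_norm N u \<le> N * (M + e / 2) + K" .
    qed
    also have "\<dots> < N * (M + e)" using K' by (simp add: algebra_simps)
    finally have "?l N / N < M + e" using N0 by (simp add: field_simps)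
    with lower show "norm (?l N / real N - M) < e" by simp
  qed
qed

lemma finite_large_atoms:
  assumes "c > 0"
  shows "finite {w. c \<le> measure \<nu> {w}}"
proof (rule ccontr)
  assume inf: "infinite {w. c \<le> measure \<nu> {w}}"
  obtain n :: nat where n: "measure \<nu> UNIV < n * c"
    using reals_Archimedean3[OF assms] by blast
  obtain B where B: "finite B" "card B = n" "B \<subseteq> {w. c \<le> measure \<nu> {w}}"
    using infinite_arbitrarily_large[OF inf] by blast
  have "n * c \<le> (\<Sum>w\<in>B. measure \<nu> {w})"
    using sum_bounded_below[of B c "\<lambda>w. measure \<nu> {w}"] B by auto
  also have "\<dots> = measure \<nu> B"
    using finite_measure_eq_sum_singleton[OF B(1)] by (simp add: sets_eq)
  also have "\<dots> \<le> measure \<nu> UNIV"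
    using bounded_measure[of B] by (simp add: space_eq)
  finally show False using n by simp
qed

text \<open>
  If some atom has positive mass, only finitely many are at least as heavy, since their total mass is finite;
  a heaviest one is found among these. Without atoms every point of the circle will do.
\<close>

lemma greatest_atom_exists:
  obtains w where "norm w = 1" "\<And>u. norm u = 1 \<Longrightarrow> measure \<nu> {u} \<le> measure \<nu> {w}"
proof (cases "\<exists>u. norm u = 1 \<and> measure \<nu> {u} \<noteq> 0")
  case False
  then show ?thesis by (intro that[of 1]) auto
next
  case True
  then obtain u where u: "norm u = 1" "measure \<nu> {u} > 0"
    by (auto simp: zero_less_measure_iff)
  define S where "S = {w. norm w = 1 \<and> measure \<nu> {u} \<le> measure \<nu> {w}}"
  have fin: "finite S"
    by (rule finite_subset[OF _ finite_large_atoms[OF u(2)]]) (auto simp: S_def)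
  have "u \<in> S" using u by (simp add: S_def)
  then have "Max ((\<lambda>w. measure \<nu> {w}) ` S) \<in> (\<lambda>w. measure \<nu> {w}) ` S"
    using fin by (intro Max_in) auto
  then obtain w where w: "w \<in> S" "Max ((\<lambda>w. measure \<nu> {w}) ` S) = measure \<nu> {w}" by auto
  have S_le: "measure \<nu> {v} \<le> measure \<nu> {w}" if "v \<in> S" for v
    unfolding w(2)[symmetric] using fin that by (intro Max_ge) auto
  show ?thesis
  proof (rule that)
    show "norm w = 1" using w(1) by (simp add: S_def)
    fix v :: complex assume "norm v = 1"
    then show "measure \<nu> {v} \<le> measure \<nu> {w}"
      using S_le[of v] S_le[OF \<open>u \<in> S\<close>] by (cases "v \<in> S") (auto simp: S_def)
  qed
qed

end

section \<open>From jumps to atoms\<close>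

lemma clamped_tendsto_left:
  assumes "mono_on {-pi..pi} \<sigma>"
  shows "(clamped \<sigma> \<longlongrightarrow> Lim (at_left x) (clamped \<sigma>)) (at_left x)"
proof -
  have "(clamped \<sigma> \<longlongrightarrow> Sup (clamped \<sigma> ` ({..<x} \<inter> UNIV))) (at x within ({..<x} \<inter> UNIV))"
    by (rule Lim_left_bound[where K = "clamped \<sigma> x"]) (auto intro: monoD[OF mono_clamped[OF assms]])
  then show ?thesis by (metis Int_UNIV_right tendsto_Lim trivial_limit_at_left_real)
qed

lemma sets_stieltjes_measure [simp, measurable_cong]: "sets (stieltjes_measure \<sigma>) = sets borel"
  and space_stieltjes_measure [simp]: "space (stieltjes_measure \<sigma>) = UNIV"
  by (simp_all add: stieltjes_measure_def)

text \<open>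
  Half-open intervals ending at \<open>x\<close> shrink to the point, so its mass involves the left limit of
  \<^const>\<open>right_ext\<close>. It agrees with the left limit of \<^const>\<open>clamped\<close> because
  \<open>clamped \<sigma> y \<le> right_ext \<sigma> y \<le> clamped \<sigma> ((x + y) / 2)\<close> for \<open>y < x\<close>.
\<close>

lemma measure_stieltjes_singleton:
  assumes "mono_on {-pi..pi} \<sigma>"
  shows "measure (stieltjes_measure \<sigma>) {x} = right_ext \<sigma> x - Lim (at_left x) (clamped \<sigma>)"
proof -
  let ?\<mu> = "stieltjes_measure \<sigma>" and ?L = "Lim (at_left x) (clamped \<sigma>)"
  let ?a = "\<lambda>n. x - inverse (real (Suc n))"
  have left: "filterlim ?a (at_left x) sequentially"
    unfolding filterlim_at
  proof
    show "\<forall>\<^sub>F n in sequentially. ?a n \<in> {..<x} \<and> ?a n \<noteq> x" by simp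
    show "?a \<longlonglongrightarrow> x"
      using tendsto_diff[OF tendsto_const LIMSEQ_inverse_real_of_nat, of x] by simp
  qed
  have "(\<lambda>n. measure ?\<mu> {?a n<..x}) \<longlonglongrightarrow> measure ?\<mu> (\<Inter>n. {?a n<..x})"
  proof (rule Lim_measure_decseq)
    show "range (\<lambda>n. {?a n<..x}) \<subseteq> sets ?\<mu>" by auto
    show "decseq (\<lambda>n. {?a n<..x})"
    proof (rule decseq_SucI)
      fix n
      have "?a n \<le> ?a (Suc n)" by (simp add: field_simps)
      then show "{?a (Suc n)<..x} \<subseteq> {?a n<..x}"
        by (meson greaterThanAtMost_iff order.strict_trans1 subsetI)
    qed
    show "emeasure ?\<mu> {?a n<..x} \<noteq> \<infinity>" for n
      using assms by (subst emeasure_stieltjes_measure_Ioc) auto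
  qed
  also have "(\<Inter>n. {?a n<..x}) = {x}"
  proof -
    have "y = x" if gt: "\<And>n. ?a n < y" and le: "y \<le> x" for y
    proof (rule ccontr)
      assume "y \<noteq> x"
      then obtain n where "inverse (real (Suc n)) < x - y"
        using le reals_Archimedean[of "x - y"] by auto
      with gt[of n] show False by simp
    qed
    then show ?thesis by auto
  qed
  also have "(\<lambda>n. measure ?\<mu> {?a n<..x}) = (\<lambda>n. right_ext \<sigma> x - right_ext \<sigma> (?a n))"
    using assms by (intro ext) (simp add: measure_def emeasure_stieltjes_measure_Ioc mono_right_ext)
  finally have lim: "(\<lambda>n. right_ext \<sigma> x - right_ext \<sigma> (?a n)) \<longlonglongrightarrow> measure ?\<mu> {x}" .
  have "(right_ext \<sigma> \<longlongrightarrow> ?L) (at_left x)"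
  proof (rule tendsto_sandwich)
    show "\<forall>\<^sub>F y in at_left x. clamped \<sigma> y \<le> right_ext \<sigma> y"
      by (simp add: clamped_le_right_ext[OF assms])
    show "\<forall>\<^sub>F y in at_left x. right_ext \<sigma> y \<le> clamped \<sigma> ((x + y) / 2)"
      unfolding eventually_at_filter by (intro always_eventually) (auto intro: right_ext_le_clamped[OF assms])
    show "(clamped \<sigma> \<longlongrightarrow> ?L) (at_left x)" by (rule clamped_tendsto_left[OF assms])
    have "filterlim (\<lambda>y. (x + y) / 2) (at_left x) (at_left x)"
      unfolding filterlim_at[of _ _ "{..<x}"]
    proof
      show "\<forall>\<^sub>F y in at_left x. (x + y) / 2 \<in> {..<x} \<and> (x + y) / 2 \<noteq> x"
        unfolding eventually_at_filter by (intro always_eventually) auto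
      show "((\<lambda>y. (x + y) / 2) \<longlongrightarrow> x) (at_left x)"
        by (rule tendsto_eq_intros refl | simp)+
    qed
    then show "((\<lambda>y. clamped \<sigma> ((x + y) / 2)) \<longlongrightarrow> ?L) (at_left x)"
      by (rule filterlim_compose[OF clamped_tendsto_left[OF assms]])
  qed
  then have "(\<lambda>n. right_ext \<sigma> (?a n)) \<longlonglongrightarrow> ?L"
    by (rule filterlim_compose[OF _ left])
  then have "(\<lambda>n. right_ext \<sigma> x - right_ext \<sigma> (?a n)) \<longlonglongrightarrow> right_ext \<sigma> x - ?L"
    by (intro tendsto_diff tendsto_const)
  with lim show ?thesis by (rule LIMSEQ_unique)
qed

definition circle_image :: "(real \<Rightarrow> real) \<Rightarrow> complex measure" where
  "circle_image \<sigma> = distr (restrict_space (stieltjes_measure \<sigma>) {-pi..pi}) borel cis"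

lemma measurable_cis_restrict:
  "cis \<in> measurable (restrict_space (stieltjes_measure \<sigma>) {-pi..pi}) borel"
proof (rule measurable_restrict_space1)
  have "cis \<in> borel_measurable borel"
    by (intro borel_measurable_continuous_onI continuous_on_cis continuous_on_id)
  then show "cis \<in> measurable (stieltjes_measure \<sigma>) borel" by simp
qed

lemma emeasure_stieltjes_Icc_finite:
  assumes "mono_on {-pi..pi} \<sigma>"
  shows "emeasure (stieltjes_measure \<sigma>) {-pi..pi} \<noteq> \<infinity>"
proof -
  have "emeasure (stieltjes_measure \<sigma>) {-pi..pi} \<le> emeasure (stieltjes_measure \<sigma>) {-pi - 1<..pi}"
    by (intro emeasure_mono) auto
  also have "\<dots> < \<infinity>"
  proof -
    have "- pi - 1 \<le> pi" using pi_gt_zero by linarith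
    then show ?thesis by (simp add: emeasure_stieltjes_measure_Ioc[OF assms])
  qed
  finally show ?thesis by simp
qed

lemma circle_measure_circle_image:
  assumes "mono_on {-pi..pi} \<sigma>"
  shows "circle_measure (circle_image \<sigma>)"
proof -
  let ?R = "restrict_space (stieltjes_measure \<sigma>) {-pi..pi}"
  have "finite_measure ?R"
  proof (rule finite_measureI)
    show "emeasure ?R (space ?R) \<noteq> \<infinity>"
      using emeasure_stieltjes_Icc_finite[OF assms]
      by (simp add: space_restrict_space emeasure_restrict_space)
  qed
  then interpret finite_measure "circle_image \<sigma>"
    unfolding circle_image_def by (rule finite_measure.finite_measure_distr[OF _ measurable_cis_restrict])
  show ?thesis
  proof
    show "sets (circle_image \<sigma>) = sets borel" by (simp add: circle_image_def)
    show "AE z in circle_image \<sigma>. norm z = 1"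
      unfolding circle_image_def by (subst AE_distr_iff[OF measurable_cis_restrict]) auto
  qed
qed

lemma fourier_stieltjes_eq_moment:
  "fourier_stieltjes \<sigma> (int j - int k) = (LINT z|circle_image \<sigma>. z ^ j * cnj z ^ k)"
proof -
  let ?R = "restrict_space (stieltjes_measure \<sigma>) {-pi..pi}"
  have "(LINT z|circle_image \<sigma>. z ^ j * cnj z ^ k) = (LINT \<theta>|?R. cis \<theta> ^ j * cnj (cis \<theta>) ^ k)"
    unfolding circle_image_def
    by (intro integral_distr measurable_cis_restrict borel_measurable_continuous_onI continuous_intros)
  also have "\<dots> = (LINT \<theta>|?R. exp (\<i> * of_int (int j - int k) * of_real \<theta>))"
  proof (intro Bochner_Integration.integral_cong refl)
    fix \<theta>
    have "cis \<theta> ^ j * cnj (cis \<theta>) ^ k = cis (real j * \<theta> + real k * (- \<theta>))"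
      by (simp only: cis_cnj Complex.DeMoivre cis_mult)
    also have "\<dots> = exp (\<i> * of_int (int j - int k) * of_real \<theta>)"
      by (simp add: cis_conv_exp algebra_simps)
    finally show "cis \<theta> ^ j * cnj (cis \<theta>) ^ k = exp (\<i> * of_int (int j - int k) * of_real \<theta>)" .
  qed
  also have "\<dots> = fourier_stieltjes \<sigma> (int j - int k)"
    unfolding fourier_stieltjes_def set_lebesgue_integral_def
    by (subst integral_restrict_space) auto
  finally show ?thesis by simp
qed

text \<open>
  The only point of the circle with two preimages in \<open>[-\<pi>, \<pi>]\<close> is \<open>-1\<close>, and there the masses
  of \<open>-\<pi>\<close> and \<open>\<pi>\<close> add up, in accordance with the special case in \<^const>\<open>jump\<close>. The constant continuation outside
  \<open>[-\<pi>, \<pi>]\<close> provides the outer one-sided limits \<open>\<sigma>(-\<pi>)\<close> and \<open>\<sigma>(\<pi>)\<close> at the two end points.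
\<close>

lemma measure_circle_image_cis:
  assumes mono: "mono_on {-pi..pi} \<sigma>" and \<theta>: "\<theta> \<in> {-pi<..pi}"
  shows "measure (circle_image \<sigma>) {cis \<theta>} = jump \<sigma> \<theta>"
proof -
  let ?\<mu> = "stieltjes_measure \<sigma>"
  have right: "right_ext \<sigma> x = Lim (at_right x) \<sigma>" if "x \<in> {-pi..<pi}" for x
  proof -
    have "eventually (\<lambda>y. y \<in> {x<..<pi}) (at_right x)"
      using that by (intro eventually_at_right_real) auto
    then have "\<forall>\<^sub>F y in at_right x. clamped \<sigma> y = \<sigma> y"
      by eventually_elim (use that in \<open>auto simp: clamped_def max_def min_def\<close>)
    then have "(\<sigma> \<longlongrightarrow> right_ext \<sigma> x) (at_right x)"
      using clamped_tendsto_right_ext[OF mono] by (rule Lim_transform_eventually[rotated])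
    then show ?thesis by (intro tendsto_Lim[symmetric]) auto
  qed
  have left: "Lim (at_left x) (clamped \<sigma>) = Lim (at_left x) \<sigma>" if "x \<in> {-pi<..pi}" for x
  proof -
    have "eventually (\<lambda>y. y \<in> {-pi<..<x}) (at_left x)"
      using that by (intro eventually_at_left_real) auto
    then have "\<forall>\<^sub>F y in at_left x. clamped \<sigma> y = \<sigma> y"
      by eventually_elim (use that in \<open>auto simp: clamped_def max_def min_def\<close>)
    then have "(\<sigma> \<longlongrightarrow> Lim (at_left x) (clamped \<sigma>)) (at_left x)"
      using clamped_tendsto_left[OF mono] by (rule Lim_transform_eventually[rotated])
    then show ?thesis by (intro tendsto_Lim[symmetric]) auto
  qed
  have right_pi: "right_ext \<sigma> pi = \<sigma> pi"
    unfolding right_ext_def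
  proof (rule tendsto_Lim)
    have "\<forall>\<^sub>F y in at_right pi. \<sigma> pi = clamped \<sigma> y"
      by (rule eventually_mono[OF eventually_at_right_less]) (auto simp: clamped_def max_def min_def)
    then show "(clamped \<sigma> \<longlongrightarrow> \<sigma> pi) (at_right pi)"
      by (rule Lim_transform_eventually[OF tendsto_const])
  qed simp
  have left_mpi: "Lim (at_left (-pi)) (clamped \<sigma>) = \<sigma> (-pi)"
  proof (rule tendsto_Lim)
    have "\<sigma> (-pi) = clamped \<sigma> y" if "y < -pi" for y
    proof -
      have "max (- pi) (min pi y) = - pi" using that pi_gt_zero by linarith
      then show ?thesis by (simp add: clamped_def)
    qed
    then have "\<forall>\<^sub>F y in at_left (-pi). \<sigma> (-pi) = clamped \<sigma> y"
      unfolding eventually_at_filter by (intro always_eventually) auto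
    then show "(clamped \<sigma> \<longlongrightarrow> \<sigma> (-pi)) (at_left (-pi))"
      by (rule Lim_transform_eventually[OF tendsto_const])
  qed simp
  have "measure (circle_image \<sigma>) {cis \<theta>}
      = measure (restrict_space ?\<mu> {-pi..pi}) (cis -` {cis \<theta>} \<inter> {-pi..pi})"
    unfolding circle_image_def
    by (subst measure_distr[OF measurable_cis_restrict]) (auto simp: space_restrict_space)
  also have "\<dots> = measure ?\<mu> (cis -` {cis \<theta>} \<inter> {-pi..pi})"
    by (rule measure_restrict_space) auto
  finally have eq: "measure (circle_image \<sigma>) {cis \<theta>} = measure ?\<mu> (cis -` {cis \<theta>} \<inter> {-pi..pi})" .
  have cis_eq: "cis \<phi> = cis \<theta> \<longleftrightarrow> \<phi> = \<theta>" if "\<phi> \<in> {-pi<..pi}" for \<phi>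
    using Arg_cis[OF that] Arg_cis[OF \<theta>] by metis
  have cis_mpi: "cis (-pi) = cis \<theta> \<longleftrightarrow> \<theta> = pi"
  proof -
    have "cis (-pi) = cis pi" by (simp add: complex_eq_iff)
    then show ?thesis using cis_eq[of pi] pi_gt_zero by (metis greaterThanAtMost_iff neg_less_pos order_refl)
  qed
  show ?thesis
  proof (cases "\<theta> = pi")
    case True
    have "cis -` {cis \<theta>} \<inter> {-pi..pi} = {-pi} \<union> {pi}"
    proof (intro equalityI subsetI)
      fix \<phi> assume "\<phi> \<in> cis -` {cis \<theta>} \<inter> {-pi..pi}"
      then show "\<phi> \<in> {-pi} \<union> {pi}" using cis_eq[of \<phi>] True by (cases "\<phi> = -pi") auto
    qed (use True cis_mpi in auto)
    moreover have "measure ?\<mu> ({-pi} \<union> {pi}) = measure ?\<mu> {-pi} + measure ?\<mu> {pi}"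
    proof (rule measure_Union)
      have "emeasure ?\<mu> {x} \<noteq> \<infinity>" if "x \<in> {-pi..pi}" for x
        using emeasure_mono[of "{x}" "{-pi..pi}" ?\<mu>] emeasure_stieltjes_Icc_finite[OF mono] that
        by (auto simp: top_unique)
      then show "emeasure ?\<mu> {-pi} \<noteq> \<infinity>" "emeasure ?\<mu> {pi} \<noteq> \<infinity>"
        by simp_all
    qed auto
    ultimately show ?thesis
      using True eq right[of "-pi"] left[of pi]
      by (simp add: measure_stieltjes_singleton[OF mono] right_pi left_mpi jump_def)
  next
    case False
    have "cis -` {cis \<theta>} \<inter> {-pi..pi} = {\<theta>}"
    proof (intro equalityI subsetI)
      fix \<phi> assume "\<phi> \<in> cis -` {cis \<theta>} \<inter> {-pi..pi}"
      then show "\<phi> \<in> {\<theta>}" using cis_eq[of \<phi>] False cis_mpi by (cases "\<phi> = -pi") auto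
    qed (use \<theta> in auto)
    then show ?thesis
      using False \<theta> eq right[of \<theta>] left[of \<theta>]
      by (simp add: measure_stieltjes_singleton[OF mono] jump_def)
  qed
qed

lemma max_jump_eqI:
  assumes \<theta>: "\<theta> \<in> {-pi<..pi}"
    and max: "\<And>\<phi>. \<phi> \<in> {-pi<..pi} \<Longrightarrow> 0 \<le> jump \<sigma> \<phi> \<and> jump \<sigma> \<phi> \<le> jump \<sigma> \<theta>"
  shows "max_jump \<sigma> = jump \<sigma> \<theta>"
proof (cases "jump_points \<sigma> = {}")
  case True
  then show ?thesis using \<theta> by (auto simp: max_jump_def jump_points_def)
next
  case False
  then obtain \<phi> where "\<phi> \<in> {-pi<..pi}" "jump \<sigma> \<phi> \<noteq> 0" by (auto simp: jump_points_def)
  with max[of \<phi>] have "jump \<sigma> \<theta> \<noteq> 0" by linarith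
  then have "(GREATEST m. m \<in> jump \<sigma> ` jump_points \<sigma>) = jump \<sigma> \<theta>"
    using \<theta> max by (intro Greatest_equality) (auto simp: jump_points_def)
  then show ?thesis using False by (simp add: max_jump_def)
qed

theorem theorem3p2:
  fixes \<sigma> :: "real \<Rightarrow> real"
  assumes "mono_on {-pi..pi} \<sigma>"
    and "bounded (\<sigma> ` {-pi..pi})"
  shows "(\<lambda>N. max_eigenvalue (toeplitz (fourier_stieltjes \<sigma>) N) / real N) \<longlonglongrightarrow> max_jump \<sigma>"
proof -
  interpret circle_measure "circle_image \<sigma>"
    by (rule circle_measure_circle_image[OF assms(1)])
  note atom = measure_circle_image_cis[OF assms(1)]
  obtain w where w: "norm w = 1"
    "\<And>u. norm u = 1 \<Longrightarrow> measure (circle_image \<sigma>) {u} \<le> measure (circle_image \<sigma>) {w}"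
    using greatest_atom_exists by blast
  have Arg: "Arg w \<in> {-pi<..pi}" "cis (Arg w) = w"
    using w(1) Arg_bounded[of w] cis_Arg[of w] by (cases "w = 0"; auto simp: sgn_div_norm)+
  have "max_jump \<sigma> = jump \<sigma> (Arg w)"
  proof (rule max_jump_eqI[OF Arg(1)])
    show "0 \<le> jump \<sigma> \<phi> \<and> jump \<sigma> \<phi> \<le> jump \<sigma> (Arg w)" if "\<phi> \<in> {-pi<..pi}" for \<phi>
      using w(2)[of "cis \<phi>"] Arg(2) by (simp flip: atom[OF that] atom[OF Arg(1)])
  qed
  then have "measure (circle_image \<sigma>) {w} = max_jump \<sigma>"
    using atom[OF Arg(1)] Arg(2) by simp
  then have "(\<lambda>N. max_eigenvalue (Matrix.mat N N (\<lambda>(j, k). moment j k)) / real N) \<longlonglongrightarrow> max_jump \<sigma>"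
    using w by (intro max_eigenvalue_over_size_tendsto[of _ w]) auto
  then show ?thesis
    by (simp add: toeplitz_def fourier_stieltjes_eq_moment moment_def)
qed

end
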